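(* Let $d$ be a positive integer and let $G$ be a graph on $d+2$ vertices whose adjacency matrix $A_G$ has eigenvalues $\lambda_1 \geq \lambda_2 \geq \dots \geq \lambda_{d+2}$. Let $J$ be the $(d+2)\times(d+2)$ all-ones matrix and $P = I - \frac{1}{d+2}J$ the orthogonal projection onto the subspace orthogonal to the all-ones vector. Then $G$ has a spherical representation in $\mathbb{R}^d$ if and only if the maximum eigenvalue of $PA_GP$ equals $\lambda_2$ and the multiplicity of $\lambda_2$ as an eigenvalue of $A_G$ (excluding $\lambda_1$, i.e. counted one less, if $\lambda_1 = \lambda_2$) equals the multiplicity of $\lambda_2$ as an eigenvalue of $PA_GP$.
   Context: Graphs are finite and simple; $A_G$ is the adjacency matrix of $G$ and its eigenvalues are listed with multiplicity. A finite set $S \subset \mathbb{R}^d$ is a 2-distance set if the set $\{\|p-q\| : p,q \in S, p \neq q\}$ has exactly two elements $\alpha_1 > \alpha_2$; its distance ratio is $k = \alpha_1/\alpha_2 > 1$. The associated graph of $S$ has vertex set $S$, with $p,q$ adjacent iff $\|p-q\| = \alpha_1$. A graph $G$ is representable in $\mathbb{R}^d$ with ratio $k$ if there is a 2-distance set in $\mathbb{R}^d$ with distance ratio $k$ whose associated graph is $G$. $G$ has a spherical representation in $\mathbb{R}^d$ if there is such a 2-distance set $S \subset \mathbb{R}^d$ whose points all lie on a $(d-1)$-dimensional sphere in $\mathbb{R}^d$. *)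

theory Defs
  imports "HOL-Analysis.Analysis" "Jordan_Normal_Form.Char_Poly"
begin

definition simple_graph :: "nat \<Rightarrow> (nat \<Rightarrow> nat \<Rightarrow> bool) \<Rightarrow> bool" where
  "simple_graph n E \<longleftrightarrow> (\<forall>i j. E i j \<longrightarrow> i < n \<and> j < n) \<and> (\<forall>i j. E i j \<longleftrightarrow> E j i) \<and> (\<forall>i. \<not> E i i)"

definition adj_mat :: "nat \<Rightarrow> (nat \<Rightarrow> nat \<Rightarrow> bool) \<Rightarrow> real mat" where
  "adj_mat n E = mat n n (\<lambda>(i, j). if E i j then 1 else 0)"

definition ones_mat :: "nat \<Rightarrow> real mat" where
  "ones_mat n = mat n n (\<lambda>_. 1)"

definition proj_mat :: "nat \<Rightarrow> real mat" where
  "proj_mat n = 1\<^sub>m n - (1 / real n) \<cdot>\<^sub>m ones_mat n"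

definition eig_mult :: "real mat \<Rightarrow> real \<Rightarrow> nat" where
  "eig_mult M x = order x (char_poly M)"

definition max_eigenvalue :: "real mat \<Rightarrow> real" where
  "max_eigenvalue M = Max {x. eigenvalue M x}"

definition two_distance_rep ::
  "nat \<Rightarrow> (nat \<Rightarrow> nat \<Rightarrow> bool) \<Rightarrow> (nat \<Rightarrow> 'a::euclidean_space) \<Rightarrow> real \<Rightarrow> real \<Rightarrow> bool" where
  "two_distance_rep n E p a1 a2 \<longleftrightarrow>
     inj_on p {0..<n} \<and> a1 > a2 \<and>
     {dist (p i) (p j) | i j. i < n \<and> j < n \<and> i \<noteq> j} = {a1, a2} \<and>
     (\<forall>i<n. \<forall>j<n. i \<noteq> j \<longrightarrow> (E i j \<longleftrightarrow> dist (p i) (p j) = a1))"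

definition spherical_rep ::
  "('a::euclidean_space) itself \<Rightarrow> nat \<Rightarrow> (nat \<Rightarrow> nat \<Rightarrow> bool) \<Rightarrow> bool" where
  "spherical_rep _ n E \<longleftrightarrow>
     (\<exists>(p :: nat \<Rightarrow> 'a) a1 a2 c r. two_distance_rep n E p a1 a2 \<and> r > 0 \<and>
        (\<forall>i<n. dist (p i) c = r))"

end

theory Submission
  imports Defs
begin

text \<open>
  Let \<open>u\<close> be the all-ones vector and let \<open>m\<close> be the largest eigenvalue of \<open>P A P\<close>. For points
  \<open>p i\<close> with squared distances \<open>\<alpha>\<^sub>1\<^sup>2\<close> on edges and \<open>\<alpha>\<^sub>2\<^sup>2\<close> on non-edges, the form of \<open>s I - A\<close>
  with \<open>s = \<alpha>\<^sub>2\<^sup>2 / (\<alpha>\<^sub>1\<^sup>2 - \<alpha>\<^sub>2\<^sup>2)\<close> is, on the orthogonal complement of \<open>u\<close>, a positive multiple of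
  the squared norm of \<open>\<Sum>i. x i p i\<close>; a set of \<open>d + 2\<close> points in dimension \<open>d\<close> has an affine dependency,
  which forces \<open>s = m\<close>. If the points lie on a sphere, each affine dependency \<open>x\<close> satisfies
  \<open>A x = m x\<close>; conversely this condition is exactly the solvability of the linear system for the
  centre. So a spherical representation exists iff \<open>m > 0\<close> and the \<open>m\<close>-eigenspace of \<open>P A P\<close> lies in
  that of \<open>A\<close>. Interlacing, together with a Perron vector (an eigenvector for \<open>\<lambda>\<^sub>1\<close> not orthogonal
  to \<open>u\<close>), turns this inclusion into \<open>m = \<lambda>\<^sub>2\<close> and an equality of multiplicities.

  Matrices of size \<open>d + 2\<close> act on the Euclidean space \<open>'a \<times> real \<times> real\<close>, whose dimension is \<open>d + 2\<close>
  when \<open>'a\<close> has dimension \<open>d\<close>.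
\<close>

no_notation scalar_prod (infix "\<bullet>" 70)
hide_const (open) Matrix.orthogonal
hide_fact (open) Matrix.orthogonal_def

section \<open>Self-adjoint operators\<close>

definition selfadjoint :: "('b::euclidean_space \<Rightarrow> 'b) \<Rightarrow> bool" where
  "selfadjoint f \<longleftrightarrow> linear f \<and> (\<forall>x y. f x \<bullet> y = x \<bullet> f y)"

definition eigenspace :: "('b::euclidean_space \<Rightarrow> 'b) \<Rightarrow> real \<Rightarrow> 'b set" where
  "eigenspace f l = {x. f x = l *\<^sub>R x}"

lemma selfadjoint_linear: "selfadjoint f \<Longrightarrow> linear f"
  and selfadjoint_inner: "selfadjoint f \<Longrightarrow> f x \<bullet> y = x \<bullet> f y"
  by (auto simp: selfadjoint_def)

section \<open>Extremal values of quadratic forms and the spectral theorem\<close>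

lemma selfadjoint_shift:
  assumes "selfadjoint f"
  shows "selfadjoint (\<lambda>x. l *\<^sub>R x - f x)"
  using assms unfolding selfadjoint_def
  by (auto intro!: linear_compose_sub linear_scaleR simp: inner_diff_left inner_diff_right)

lemma subspace_eigenspace:
  assumes "linear f"
  shows "subspace (eigenspace f l)"
  by (auto simp: subspace_def eigenspace_def linear_0[OF assms] linear_add[OF assms]
      linear_scale[OF assms] scaleR_add_right)

text \<open>Degenerate case of Cauchy-Schwarz: at a zero of a nonnegative form the first variation
  vanishes in every direction \<open>w\<close> of \<open>V\<close>.\<close>

lemma nonneg_form_null_vector:
  assumes h: "selfadjoint h" and V: "subspace V"
    and nonneg: "\<And>x. x \<in> V \<Longrightarrow> 0 \<le> x \<bullet> h x"
    and v: "v \<in> V" "v \<bullet> h v = 0" and w: "w \<in> V"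
  shows "w \<bullet> h v = 0"
proof -
  define a where "a = w \<bullet> h v"
  define b where "b = w \<bullet> h w"
  \<comment> \<open>Close to the minimiser \<open>- a / b\<close> of the form along
    \<open>w\<close>; the added 1 avoids division by zero and still makes the value strictly
    negative unless \<open>a = 0\<close>.\<close>
  define s where "s = - a / (b + 1)"
  have b: "b \<ge> 0" using nonneg[OF w] by (simp add: b_def)
  have a: "a = - s * (b + 1)" using b by (simp add: s_def)
  have "0 \<le> (v + s *\<^sub>R w) \<bullet> h (v + s *\<^sub>R w)"
    by (intro nonneg subspace_add[OF V] subspace_scale[OF V] v w)
  also have "\<dots> = 2 * s * a + s\<^sup>2 * b"
    using v(2) selfadjoint_inner[OF h, of v w] linear_add[OF selfadjoint_linear[OF h]]
      linear_scale[OF selfadjoint_linear[OF h]]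
    by (simp add: inner_add_left inner_add_right a_def b_def power2_eq_square inner_commute algebra_simps)
  also have "\<dots> = - (s\<^sup>2 * (b + 2))"
    unfolding a by (simp add: algebra_simps power2_eq_square)
  finally have "s = 0"
    using b by (simp add: mult_le_0_iff)
  then show ?thesis using a by (simp add: a_def)
qed

text \<open>Equality case of a Rayleigh bound: \<open>v\<close> is a null vector of the nonnegative
  form of \<open>l I - f\<close>, and the residual of \<open>v\<close> is tested against
  itself.\<close>

lemma form_bound_attained_imp_eigenvector:
  assumes f: "selfadjoint f" and le: "\<And>x. x \<bullet> f x \<le> l * (x \<bullet> x)" and v: "v \<bullet> f v = l * (v \<bullet> v)"
  shows "f v = l *\<^sub>R v"
proof -
  let ?h = "\<lambda>x. l *\<^sub>R x - f x"
  have "0 \<le> x \<bullet> ?h x" for x using le[of x] by (simp add: inner_diff_right)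
  moreover have "v \<bullet> ?h v = 0" using v by (simp add: inner_diff_right)
  ultimately have "?h v \<bullet> ?h v = 0"
    using nonneg_form_null_vector[OF selfadjoint_shift[OF f] subspace_UNIV] by blast
  then show ?thesis by simp
qed

text \<open>The form attains its maximum on the compact unit sphere of \<open>V\<close>. Invariance
  of \<open>V\<close> keeps the residual at a maximiser inside \<open>V\<close>, where it must
  vanish.\<close>

lemma selfadjoint_top_eigenvector:
  assumes f: "selfadjoint f" and V: "subspace V" "f ` V \<subseteq> V" "V \<noteq> {0}"
  obtains v l where "v \<in> V" "norm v = 1" "f v = l *\<^sub>R v" "\<And>x. x \<in> V \<Longrightarrow> x \<bullet> f x \<le> l * (x \<bullet> x)"
proof -
  let ?S = "V \<inter> sphere 0 1"
  obtain z where z: "z \<in> V" "z \<noteq> 0" using V subspace_0 by blast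
  then have "z /\<^sub>R norm z \<in> ?S" using subspace_scale[OF V(1)] by simp
  then have ne: "?S \<noteq> {}" by blast
  have comp: "compact ?S" using closed_Int_compact[OF closed_subspace[OF V(1)] compact_sphere] .
  have cont: "continuous_on ?S (\<lambda>x. x \<bullet> f x)"
    by (intro continuous_intros linear_continuous_on linear_conv_bounded_linear[THEN iffD1] selfadjoint_linear f)
  obtain v where v: "v \<in> ?S" and vmax: "\<And>x. x \<in> ?S \<Longrightarrow> x \<bullet> f x \<le> v \<bullet> f v"
    using continuous_attains_sup[OF comp ne cont] by blast
  define l where "l = v \<bullet> f v"
  have vv: "v \<bullet> v = 1" using v by (simp add: norm_eq_1)
  have le: "x \<bullet> f x \<le> l * (x \<bullet> x)" if "x \<in> V" for x
  proof (cases "x = 0")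
    case False
    then have "x /\<^sub>R norm x \<in> ?S" using that subspace_scale[OF V(1)] by simp
    from vmax[OF this] have "(x \<bullet> f x) / (x \<bullet> x) \<le> l"
      using False by (simp add: linear_scale[OF selfadjoint_linear[OF f]] l_def
          power2_norm_eq_inner[symmetric] power2_eq_square divide_simps)
    then show ?thesis using False by (simp add: pos_divide_le_eq)
  qed simp
  let ?h = "\<lambda>x. l *\<^sub>R x - f x"
  have "?h v \<in> V" using v V subspace_diff subspace_scale by (metis IntD1 image_subset_iff)
  moreover have "0 \<le> x \<bullet> ?h x" if "x \<in> V" for x
    using le[OF that] by (simp add: inner_diff_right)
  moreover have "v \<bullet> ?h v = 0" by (simp add: inner_diff_right vv flip: l_def)
  ultimately have "?h v \<bullet> ?h v = 0"
    using nonneg_form_null_vector[OF selfadjoint_shift[OF f] V(1)] v by blast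
  then have "f v = l *\<^sub>R v" by simp
  then show ?thesis using that v le by auto
qed

text \<open>Spectral theorem by induction on the dimension: split off a top eigenvector and continue
  in its orthogonal complement, which is again invariant. Writing the eigenvalue of a unit vector as
  \<open>b \<bullet> f b\<close> avoids a separate eigenvalue function.\<close>

lemma selfadjoint_orthonormal_eigenbasis_subspace:
  assumes f: "selfadjoint f" and V: "subspace V" "f ` V \<subseteq> V"
  shows "\<exists>B. pairwise orthogonal B \<and> (\<forall>b\<in>B. norm b = 1 \<and> f b = (b \<bullet> f b) *\<^sub>R b) \<and> span B = V"
  using V
proof (induction "dim V" arbitrary: V rule: less_induct)
  case less
  show ?case
  proof (cases "V = {0}")
    case True
    then show ?thesis by (intro exI[of _ "{}"]) auto
  next
    case False
    obtain v l where v: "v \<in> V" "norm v = 1" "f v = l *\<^sub>R v"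
      using selfadjoint_top_eigenvector[OF f less.prems False] by metis
    have vv: "v \<bullet> v = 1" using v by (simp add: norm_eq_1)
    define W where "W = {y \<in> V. v \<bullet> y = 0}"
    have W: "subspace W"
      using less.prems(1) by (auto simp: W_def subspace_def inner_add_right)
    have fW: "f ` W \<subseteq> W"
    proof
      fix y assume "y \<in> f ` W"
      then obtain x where x: "x \<in> V" "v \<bullet> x = 0" "y = f x" by (auto simp: W_def)
      have "v \<bullet> f x = f v \<bullet> x" by (simp add: selfadjoint_inner[OF f])
      then show "y \<in> W" using x v less.prems by (auto simp: W_def)
    qed
    have "v \<notin> W" using vv by (simp add: W_def)
    moreover have "W \<subseteq> V" by (auto simp: W_def)
    ultimately have "W \<subset> V" using v by blast
    then have "dim W < dim V"
      using W less.prems(1) by (metis dim_psubset span_eq_iff)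
    from less.hyps[OF this W fW] obtain B where
      B: "pairwise orthogonal B" "\<forall>b\<in>B. norm b = 1 \<and> f b = (b \<bullet> f b) *\<^sub>R b" "span B = W"
      by blast
    have perp: "v \<bullet> b = 0" if "b \<in> B" for b
      using that B(3) span_base[of b B] by (auto simp: W_def)
    have "pairwise orthogonal (insert v B)"
      using B(1) perp by (auto simp: pairwise_insert orthogonal_def inner_commute)
    moreover have "\<forall>b\<in>insert v B. norm b = 1 \<and> f b = (b \<bullet> f b) *\<^sub>R b"
      using B(2) v vv by auto
    moreover have "span (insert v B) = V"
    proof
      have "insert v B \<subseteq> V" using v B(3) span_base[of _ B] by (auto simp: W_def)
      then show "span (insert v B) \<subseteq> V" by (simp add: less.prems(1) span_minimal)
      show "V \<subseteq> span (insert v B)"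
      proof
        fix x assume x: "x \<in> V"
        have "x - (v \<bullet> x) *\<^sub>R v \<in> W"
          using x v vv less.prems(1)
          by (auto simp: W_def inner_diff_right intro!: subspace_diff subspace_scale)
        then show "x \<in> span (insert v B)" using B(3) by (auto simp: span_insert)
      qed
    qed
    ultimately show ?thesis by blast
  qed
qed

lemma selfadjoint_orthonormal_eigenbasis:
  fixes f :: "'b::euclidean_space \<Rightarrow> 'b"
  assumes f: "selfadjoint f"
  obtains B where "finite B" "card B = DIM('b)" "pairwise orthogonal B" "span B = UNIV"
    "\<And>b. b \<in> B \<Longrightarrow> norm b = 1" "\<And>b. b \<in> B \<Longrightarrow> f b = (b \<bullet> f b) *\<^sub>R b"
    "\<And>x. (\<Sum>b\<in>B. (x \<bullet> b) *\<^sub>R b) = x"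
proof -
  obtain B where B: "pairwise orthogonal B" "\<forall>b\<in>B. norm b = 1 \<and> f b = (b \<bullet> f b) *\<^sub>R b" "span B = UNIV"
    using selfadjoint_orthonormal_eigenbasis_subspace[OF f, of UNIV] by auto
  have ind: "independent B"
    using B by (intro pairwise_orthogonal_independent) auto
  have fin: "finite B" using ind by (rule independent_imp_finite)
  have "card B = DIM('b)"
    using dim_eq_card[OF _ ind, of UNIV] B(3) by simp
  moreover have "(\<Sum>b\<in>B. (x \<bullet> b) *\<^sub>R b) = x" for x
    using B fin by (intro orthonormal_basis_expand) auto
  ultimately show ?thesis using that B fin by blast
qed

text \<open>Comparing coefficients in \<open>f x = l x\<close> kills the coordinates at all basis
  vectors with another eigenvalue, so those with eigenvalue \<open>l\<close> span the
  eigenspace.\<close>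

lemma dim_eigenspace_orthonormal_eigenbasis:
  fixes f :: "'b::euclidean_space \<Rightarrow> 'b"
  assumes f: "linear f" and B: "finite B" "pairwise orthogonal B"
    "\<And>b. b \<in> B \<Longrightarrow> norm b = 1" "\<And>b. b \<in> B \<Longrightarrow> f b = e b *\<^sub>R b"
    "\<And>x. (\<Sum>b\<in>B. (x \<bullet> b) *\<^sub>R b) = x"
  shows "dim (eigenspace f l) = card {b \<in> B. e b = l}"
proof -
  let ?C = "{b \<in> B. e b = l}"
  have ind: "independent ?C"
    using B(2) B(3)[of 0] by (intro pairwise_orthogonal_independent) (auto intro: pairwise_subset)
  have "eigenspace f l \<subseteq> span ?C"
  proof
    fix x assume x: "x \<in> eigenspace f l"
    have ip: "b' \<bullet> b = (if b' = b then 1 else 0)" if "b \<in> B" "b' \<in> B" for b b'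
      using B(2,3) that by (auto simp: pairwise_def orthogonal_def norm_eq_1)
    have z: "x \<bullet> b = 0" if b: "b \<in> B" "e b \<noteq> l" for b
    proof -
      have "f x = (\<Sum>b\<in>B. (x \<bullet> b) *\<^sub>R f b)"
        by (subst B(5)[of x, symmetric]) (simp add: linear_sum[OF f] linear_scale[OF f])
      then have "f x \<bullet> b = (\<Sum>b'\<in>B. (x \<bullet> b') * (e b' * (b' \<bullet> b)))"
        using B(4) by (simp add: inner_sum_left mult.assoc)
      also have "\<dots> = (\<Sum>b'\<in>B. if b' = b then (x \<bullet> b) * e b else 0)"
        by (intro sum.cong) (use ip b in auto)
      also have "\<dots> = (x \<bullet> b) * e b" using b B(1) by simp
      finally have "l * (x \<bullet> b) = (x \<bullet> b) * e b" using x by (simp add: eigenspace_def)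
      then show ?thesis using b(2) by simp
    qed
    have "x = (\<Sum>b\<in>?C. (x \<bullet> b) *\<^sub>R b)"
      by (subst B(5)[of x, symmetric], rule sum.mono_neutral_right) (use B(1) z in auto)
    also have "\<dots> \<in> span ?C" by (intro span_sum span_scale span_base) auto
    finally show "x \<in> span ?C" .
  qed
  moreover have "?C \<subseteq> eigenspace f l" using B(4) by (auto simp: eigenspace_def)
  ultimately show ?thesis using dim_unique[OF _ _ ind refl] by blast
qed

text \<open>Fredholm alternative: the range is the orthogonal complement of the kernel. It later
  provides the centre of the sphere.\<close>

lemma selfadjoint_range:
  assumes f: "selfadjoint f" and y: "\<And>x. f x = 0 \<Longrightarrow> x \<bullet> y = 0"
  shows "y \<in> range f"
proof -
  have "adjoint f = f"
    by (rule adjoint_unique) (use selfadjoint_inner[OF f] in auto)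
  then have "f -` {0} = (range f)\<^sup>\<bottom>"
    using ker_orthogonal_comp_adjoint[OF selfadjoint_linear[OF f]] by simp
  then have "(f -` {0})\<^sup>\<bottom> = range f"
    by (simp add: orthogonal_comp_self linear_subspace_image selfadjoint_linear[OF f])
  moreover have "y \<in> (f -` {0})\<^sup>\<bottom>"
    using y by (auto simp: orthogonal_comp_def orthogonal_def)
  ultimately show ?thesis by blast
qed

text \<open>Gram factorisation: the dimension bound says that the rank of \<open>g\<close> is at
  most the dimension of \<open>'a\<close>. The map \<open>T\<close> sends each eigenvector with
  nonzero eigenvalue to its own standard basis vector, scaled by the square root of the
  eigenvalue.\<close>

lemma nonneg_selfadjoint_factor:
  fixes g :: "'b::euclidean_space \<Rightarrow> 'b"
  assumes g: "selfadjoint g" and nonneg: "\<And>x. 0 \<le> x \<bullet> g x"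
    and dim: "DIM('b) \<le> dim (eigenspace g 0) + DIM('a::euclidean_space)"
  obtains T :: "'b \<Rightarrow> 'a::euclidean_space" where "linear T" "\<And>x y. T x \<bullet> T y = x \<bullet> g y"
proof -
  obtain B where B: "finite B" "card B = DIM('b)" "pairwise orthogonal B" "span B = UNIV"
    "\<And>b. b \<in> B \<Longrightarrow> norm b = 1" "\<And>b. b \<in> B \<Longrightarrow> g b = (b \<bullet> g b) *\<^sub>R b"
    "\<And>x. (\<Sum>b\<in>B. (x \<bullet> b) *\<^sub>R b) = x"
    by (rule selfadjoint_orthonormal_eigenbasis[OF g]) (rule that)
  note lin = selfadjoint_linear[OF g]
  let ?e = "\<lambda>b. b \<bullet> g b"
  define C where "C = {b \<in> B. ?e b \<noteq> 0}"
  have "card {b \<in> B. ?e b = 0} + card C = card B"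
    using B(1) by (subst card_Un_disjoint[symmetric]) (auto simp: C_def intro!: arg_cong[where f=card])
  then have "card C \<le> card (Basis::'a set)"
    using dim B(2) dim_eigenspace_orthonormal_eigenbasis[OF lin B(1,3,5,6,7), where l=0] by simp
  then obtain \<phi> where \<phi>: "inj_on \<phi> C" "\<phi> ` C \<subseteq> (Basis::'a set)"
    using card_le_inj[of C "Basis::'a set"] B(1) by (auto simp: C_def)
  define T :: "'b \<Rightarrow> 'a" where "T x = (\<Sum>b\<in>C. (sqrt (?e b) * (x \<bullet> b)) *\<^sub>R \<phi> b)" for x
  have fC: "finite C" using B(1) by (simp add: C_def)
  have "linear T"
    unfolding T_def by (intro linearI) (simp_all add: inner_add_left ring_distribs scaleR_add_left
        sum.distrib scaleR_sum_right mult.left_commute)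
  moreover have "T x \<bullet> T y = x \<bullet> g y" for x y
  proof -
    have "T x \<bullet> T y = (\<Sum>b\<in>C. \<Sum>b'\<in>C. (sqrt (?e b) * (x \<bullet> b)) * ((sqrt (?e b') * (y \<bullet> b')) * (\<phi> b \<bullet> \<phi> b')))"
      by (simp add: T_def inner_sum_left) (simp add: inner_sum_right sum_distrib_left)
    also have "\<dots> = (\<Sum>b\<in>C. \<Sum>b'\<in>C. if b' = b then ?e b * (x \<bullet> b) * (y \<bullet> b) else 0)"
    proof (intro sum.cong refl)
      fix b b' assume b: "b \<in> C" "b' \<in> C"
      have "\<phi> b \<bullet> \<phi> b' = (if b' = b then 1 else 0)"
        using b \<phi> by (auto simp: inner_Basis inj_on_eq_iff image_subset_iff)
      then show "(sqrt (?e b) * (x \<bullet> b)) * ((sqrt (?e b') * (y \<bullet> b')) * (\<phi> b \<bullet> \<phi> b')) =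
          (if b' = b then ?e b * (x \<bullet> b) * (y \<bullet> b) else 0)"
        using nonneg[of b] by simp
    qed
    also have "\<dots> = (\<Sum>b\<in>C. ?e b * (x \<bullet> b) * (y \<bullet> b))" using fC by simp
    also have "\<dots> = (\<Sum>b\<in>B. ?e b * (x \<bullet> b) * (y \<bullet> b))"
      by (rule sum.mono_neutral_left) (auto simp: C_def B(1))
    also have "\<dots> = x \<bullet> (\<Sum>b\<in>B. (y \<bullet> b) *\<^sub>R g b)"
      unfolding inner_sum_right
    proof (intro sum.cong refl)
      fix b assume "b \<in> B"
      from arg_cong[OF B(6)[OF this], of "inner x"]
      show "?e b * (x \<bullet> b) * (y \<bullet> b) = x \<bullet> ((y \<bullet> b) *\<^sub>R g b)" by simp
    qed
    also have "(\<Sum>b\<in>B. (y \<bullet> b) *\<^sub>R g b) = g (\<Sum>b\<in>B. (y \<bullet> b) *\<^sub>R b)"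
      by (simp add: linear_sum[OF lin] linear_scale[OF lin])
    also have "\<dots> = g y" by (simp add: B(7))
    finally show ?thesis .
  qed
  ultimately show ?thesis using that by blast
qed

section \<open>Matrices as operators on a Euclidean space\<close>

text \<open>Links matrices, whose size is a number, to a Euclidean space, whose dimension is fixed
  by its type: row \<open>i\<close> corresponds to the basis vector \<open>b i\<close>.\<close>

locale basis_enumeration =
  fixes n :: nat and b :: "nat \<Rightarrow> 'b::euclidean_space"
  assumes bij: "bij_betw b {..<n} Basis"
begin

lemma DIM_eq: "DIM('b) = n"
  using bij_betw_same_card[OF bij] by simp

lemma b_in_Basis: "i < n \<Longrightarrow> b i \<in> Basis"
  using bij_betw_apply[OF bij] by simp

lemma inner_b: "i < n \<Longrightarrow> j < n \<Longrightarrow> b i \<bullet> b j = (if i = j then 1 else 0)"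
  using bij by (auto simp: b_in_Basis inner_Basis bij_betw_def inj_on_def)

lemma sum_b: "(\<Sum>i<n. h (b i)) = (\<Sum>i\<in>Basis. h i)"
  by (rule sum.reindex_bij_betw[OF bij])

lemma expand: "x = (\<Sum>i<n. (x \<bullet> b i) *\<^sub>R b i)"
  by (simp add: sum_b[of "\<lambda>i. (x \<bullet> i) *\<^sub>R i"] euclidean_representation)

lemma inner_expand: "x \<bullet> y = (\<Sum>i<n. (x \<bullet> b i) * (y \<bullet> b i))"
  by (simp add: sum_b[of "\<lambda>i. (x \<bullet> i) * (y \<bullet> i)"] euclidean_inner[of x y])

lemma eqI: "(\<And>i. i < n \<Longrightarrow> x \<bullet> b i = y \<bullet> b i) \<Longrightarrow> x = y"
  by (subst expand[of x], subst expand[of y]) simp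

lemma inner_One: "x \<bullet> One = (\<Sum>i<n. x \<bullet> b i)"
  by (simp add: sum_b[of "\<lambda>i. x \<bullet> i"] inner_sum_right)

lemma One_inner_b: "i < n \<Longrightarrow> One \<bullet> b i = 1"
  by (simp add: b_in_Basis)

lemma inner_sum_b: "i < n \<Longrightarrow> (\<Sum>j<n. c j *\<^sub>R b j) \<bullet> b i = c i"
  by (simp add: inner_sum_left inner_b if_distrib[of "(*) _"] cong: if_cong)

definition mat_op :: "real mat \<Rightarrow> 'b \<Rightarrow> 'b" where
  "mat_op A x = (\<Sum>i<n. (\<Sum>j<n. A $$ (i, j) * (x \<bullet> b j)) *\<^sub>R b i)"

lemma mat_op_inner: "i < n \<Longrightarrow> mat_op A x \<bullet> b i = (\<Sum>j<n. A $$ (i, j) * (x \<bullet> b j))"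
  by (simp add: mat_op_def inner_sum_b)

lemma linear_mat_op: "linear (mat_op A)"
  by (intro linearI eqI)
    (simp_all add: mat_op_inner inner_add_left ring_distribs sum.distrib sum_distrib_left mult_ac)

lemma mat_op_mult:
  assumes "A \<in> carrier_mat n n" "B \<in> carrier_mat n n"
  shows "mat_op (A * B) x = mat_op A (mat_op B x)"
proof (rule eqI)
  fix i assume i: "i < n"
  have "mat_op (A * B) x \<bullet> b i = (\<Sum>j<n. (\<Sum>k<n. A $$ (i, k) * B $$ (k, j)) * (x \<bullet> b j))"
    using assms i by (simp add: mat_op_inner scalar_prod_def atLeast0LessThan)
  also have "\<dots> = (\<Sum>k<n. \<Sum>j<n. A $$ (i, k) * B $$ (k, j) * (x \<bullet> b j))"
    by (subst sum.swap) (simp add: sum_distrib_right)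
  also have "\<dots> = mat_op A (mat_op B x) \<bullet> b i"
    using i by (simp add: mat_op_inner sum_distrib_left mult.assoc)
  finally show "mat_op (A * B) x \<bullet> b i = mat_op A (mat_op B x) \<bullet> b i" .
qed

lemma selfadjoint_mat_op:
  assumes "\<And>i j. i < n \<Longrightarrow> j < n \<Longrightarrow> A $$ (i, j) = A $$ (j, i)"
  shows "selfadjoint (mat_op A)"
  unfolding selfadjoint_def
proof (intro conjI allI linear_mat_op)
  fix x y
  have "mat_op A x \<bullet> y = (\<Sum>i<n. \<Sum>j<n. A $$ (i, j) * (x \<bullet> b j) * (y \<bullet> b i))"
    by (subst inner_expand) (simp add: mat_op_inner sum_distrib_right)
  also have "\<dots> = (\<Sum>j<n. \<Sum>i<n. A $$ (j, i) * (x \<bullet> b j) * (y \<bullet> b i))"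
    by (subst sum.swap) (simp add: assms)
  also have "\<dots> = x \<bullet> mat_op A y"
    by (subst inner_expand) (simp add: mat_op_inner sum_distrib_left mult_ac)
  finally show "mat_op A x \<bullet> y = x \<bullet> mat_op A y" .
qed

text \<open>The coordinate map is a linear bijection that turns \<open>mat_op A\<close> into
  multiplication by \<open>A\<close>.\<close>

lemma eigenvalue_iff_eigenspace:
  assumes A: "A \<in> carrier_mat n n"
  shows "eigenvalue A l \<longleftrightarrow> (\<exists>x\<in>eigenspace (mat_op A) l. x \<noteq> 0)"
proof -
  define coords where "coords x = vec n (\<lambda>i. x \<bullet> b i)" for x
  have mult: "A *\<^sub>v coords x = coords (mat_op A x)" for x
    using A by (intro eq_vecI) (auto simp: coords_def mat_op_inner scalar_prod_def atLeast0LessThan)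
  have scale: "l \<cdot>\<^sub>v coords x = coords (l *\<^sub>R x)" for x
    by (intro eq_vecI) (auto simp: coords_def)
  have inj: "coords x = coords y \<longleftrightarrow> x = y" for x y
  proof
    assume eq: "coords x = coords y"
    show "x = y"
    proof (rule eqI)
      fix i assume "i < n"
      then show "x \<bullet> b i = y \<bullet> b i" using arg_cong[OF eq, of "\<lambda>v. vec_index v i"] by (simp add: coords_def)
    qed
  qed simp
  have zero: "coords 0 = 0\<^sub>v n" by (intro eq_vecI) (auto simp: coords_def)
  have surj: "\<exists>x. v = coords x" if "v \<in> carrier_vec n" for v
    by (intro exI[of _ "\<Sum>i<n. vec_index v i *\<^sub>R b i"] eq_vecI)
      (use that in \<open>auto simp: coords_def inner_sum_b\<close>)
  have "eigenvector A (coords x) l \<longleftrightarrow> x \<noteq> 0 \<and> x \<in> eigenspace (mat_op A) l" for x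
  proof -
    have "coords x \<in> carrier_vec n" by (simp add: coords_def)
    then show ?thesis
      using A inj[of x 0] by (auto simp: eigenvector_def mult scale inj zero eigenspace_def)
  qed
  moreover have "eigenvector A v l \<Longrightarrow> \<exists>x. v = coords x" for v
    using A surj by (auto simp: eigenvector_def)
  ultimately show ?thesis unfolding eigenvalue_def by metis
qed

text \<open>Algebraic and geometric multiplicity agree because an orthonormal eigenbasis
  diagonalises \<open>A\<close>; both then count the diagonal entries equal to
  \<open>l\<close>.\<close>

lemma eig_mult_eq_dim_eigenspace:
  assumes A: "A \<in> carrier_mat n n" and f: "selfadjoint (mat_op A)"
  shows "eig_mult A l = dim (eigenspace (mat_op A) l)"
proof -
  let ?f = "mat_op A"
  obtain B where B: "finite B" "card B = DIM('b)" "pairwise orthogonal B" "span B = UNIV"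
    "\<And>b. b \<in> B \<Longrightarrow> norm b = 1" "\<And>b. b \<in> B \<Longrightarrow> ?f b = (b \<bullet> ?f b) *\<^sub>R b"
    "\<And>x. (\<Sum>b\<in>B. (x \<bullet> b) *\<^sub>R b) = x"
    by (rule selfadjoint_orthonormal_eigenbasis[OF f]) (rule that)
  obtain u where u: "bij_betw u {..<n} B"
    using ex_bij_betw_nat_finite[OF B(1)] B(2) by (auto simp: DIM_eq atLeast0LessThan)
  have uB: "u j \<in> B" if "j < n" for j using u that by (auto simp: bij_betw_def)
  define e where "e j = u j \<bullet> ?f (u j)" for j
  have fu: "?f (u j) = e j *\<^sub>R u j" if "j < n" for j
    using B(6)[OF uB[OF that]] by (simp add: e_def)
  have uu: "u i \<bullet> u j = (if i = j then 1 else 0)" if "i < n" "j < n" for i j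
  proof (cases "i = j")
    case True
    then show ?thesis using B(5)[OF uB] that by (simp add: norm_eq_1)
  next
    case False
    then have "u i \<noteq> u j" using u that by (auto simp: bij_betw_def inj_on_def)
    then show ?thesis using B(3) uB that False by (auto simp: pairwise_def orthogonal_def)
  qed
  \<comment> \<open>The columns of \<open>U\<close> are the eigenvectors in coordinates;
    \<open>U'\<close> is its transpose and, by orthonormality, its inverse.\<close>
  define U where "U = mat n n (\<lambda>(i, j). u j \<bullet> b i)"
  define U' where "U' = mat n n (\<lambda>(i, j). u i \<bullet> b j)"
  define D where "D = mat n n (\<lambda>(i, j). if i = j then e i else 0)"
  have carr: "U \<in> carrier_mat n n" "U' \<in> carrier_mat n n" "D \<in> carrier_mat n n"
    by (auto simp: U_def U'_def D_def)
  have U'U: "U' * U = 1\<^sub>m n"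
    by (rule eq_matI) (auto simp: U_def U'_def scalar_prod_def atLeast0LessThan uu inner_expand[symmetric])
  then have UU': "U * U' = 1\<^sub>m n"
    using mat_mult_left_right_inverse carr by blast
  have AU: "A * U = U * D"
  proof (rule eq_matI)
    fix i j assume "i < dim_row (U * D)" "j < dim_col (U * D)"
    then have ij: "i < n" "j < n" using carr by auto
    have "(A * U) $$ (i, j) = ?f (u j) \<bullet> b i"
      using ij A carr by (simp add: mat_op_inner scalar_prod_def U_def atLeast0LessThan)
    also have "\<dots> = (\<Sum>k<n. (u k \<bullet> b i) * (if k = j then e k else 0))"
      using ij by (simp add: fu mult.commute if_distrib[of "(*) _"] cong: if_cong)
    also have "\<dots> = (U * D) $$ (i, j)"
      using ij by (simp add: U_def D_def scalar_prod_def atLeast0LessThan)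
    finally show "(A * U) $$ (i, j) = (U * D) $$ (i, j)" .
  qed (use A carr in auto)
  have "A = A * (U * U')" using A UU' by simp
  also have "\<dots> = U * D * U'"
    using A carr by (metis AU assoc_mult_mat)
  finally have "similar_mat A D"
    using A carr UU' U'U by (intro similar_matI[of A D U U' n]) auto
  then have "char_poly A = char_poly D" by (rule char_poly_similar)
  also have "\<dots> = (\<Prod>a\<leftarrow>diag_mat D. [:- a, 1:])"
    using carr by (intro char_poly_upper_triangular[of _ n]) (auto simp: D_def)
  also have "diag_mat D = map e [0..<n]"
    by (auto simp: diag_mat_def D_def)
  finally have "eig_mult A l = (\<Sum>a\<leftarrow>map e [0..<n]. order l [:- a, 1:])"
    unfolding eig_mult_def by (simp only:) (subst order_prod_list, auto simp: o_def)
  also have "\<dots> = (\<Sum>j<n. order l [:- e j, 1:])"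
    by (simp add: interv_sum_list_conv_sum_set_nat atLeast0LessThan o_def)
  also have "\<dots> = (\<Sum>j<n. if e j = l then 1 else 0)"
    by (intro sum.cong refl) (auto simp: order_linear' order_linear)
  also have "\<dots> = card {j \<in> {..<n}. e j = l}"
    by (simp add: sum.If_cases Int_def)
  also have "\<dots> = card {v \<in> B. v \<bullet> ?f v = l}"
    by (rule bij_betw_same_card[of u])
      (use u in \<open>auto simp: bij_betw_def inj_on_def e_def image_def\<close>)
  also have "\<dots> = dim (eigenspace ?f l)"
    using dim_eigenspace_orthonormal_eigenbasis[OF selfadjoint_linear[OF f] B(1,3,5,6,7)] by simp
  finally show ?thesis .
qed

end

section \<open>Compression to a hyperplane\<close>

text \<open>Subtracting a suitable multiple of \<open>w\<close> moves any vector of \<open>S\<close>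
  into the hyperplane, so \<open>w\<close> spans a complement of the section.\<close>

lemma dim_Int_hyperplane:
  fixes u :: "'b::euclidean_space"
  assumes S: "subspace S" and w: "w \<in> S" "w \<bullet> u \<noteq> 0"
  shows "dim {x \<in> S. x \<bullet> u = 0} + 1 = dim S"
proof -
  let ?C = "{x \<in> S. x \<bullet> u = 0}"
  have C: "subspace ?C" using S by (auto simp: subspace_def inner_add_left)
  have "span (insert w ?C) = S"
  proof
    show "span (insert w ?C) \<subseteq> S" using S w by (intro span_minimal) auto
    show "S \<subseteq> span (insert w ?C)"
    proof
      fix x assume "x \<in> S"
      then have "x - ((x \<bullet> u) / (w \<bullet> u)) *\<^sub>R w \<in> ?C"
        using w S by (auto simp: inner_diff_left intro!: subspace_diff subspace_scale)
      then show "x \<in> span (insert w ?C)" by (auto simp: span_insert intro: span_base)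
    qed
  qed
  then have "dim S = dim (insert w ?C)" by (metis dim_span)
  also have "\<dots> = dim ?C + 1"
    using w C by (simp add: dim_insert span_eq_iff[THEN iffD2])
  finally show ?thesis by simp
qed

section \<open>Orthogonal projection along a vector and compressed operators\<close>

lemma eigenspaces_orthogonal:
  assumes f: "selfadjoint f" and "x \<in> eigenspace f k" "y \<in> eigenspace f l" "k \<noteq> l"
  shows "x \<bullet> y = 0"
  using selfadjoint_inner[OF f, of x y] assms by (auto simp: eigenspace_def)

definition hyperplane_proj :: "'b::euclidean_space \<Rightarrow> 'b \<Rightarrow> 'b" where
  "hyperplane_proj u x = x - ((x \<bullet> u) / (u \<bullet> u)) *\<^sub>R u"

definition compress :: "'b::euclidean_space \<Rightarrow> ('b \<Rightarrow> 'b) \<Rightarrow> 'b \<Rightarrow> 'b" where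
  "compress u f x = hyperplane_proj u (f (hyperplane_proj u x))"

lemma linear_hyperplane_proj: "linear (hyperplane_proj u)"
  by (intro linearI) (simp_all add: hyperplane_proj_def inner_add_left add_divide_distrib algebra_simps)

lemma hyperplane_proj_inner: "hyperplane_proj u x \<bullet> y = x \<bullet> hyperplane_proj u y"
  by (simp add: hyperplane_proj_def inner_diff_left inner_diff_right inner_commute)

lemma hyperplane_proj_id: "x \<bullet> u = 0 \<Longrightarrow> hyperplane_proj u x = x"
  by (simp add: hyperplane_proj_def)

lemma hyperplane_proj_perp: "hyperplane_proj u x \<bullet> u = 0"
  by (cases "u = 0") (simp_all add: hyperplane_proj_def inner_diff_left)

lemma hyperplane_proj_self: "hyperplane_proj u u = 0"
  by (cases "u = 0") (simp_all add: hyperplane_proj_def)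

lemma selfadjoint_compress:
  assumes f: "selfadjoint f"
  shows "selfadjoint (compress u f)"
  unfolding selfadjoint_def
proof
  have "compress u f = hyperplane_proj u \<circ> (f \<circ> hyperplane_proj u)"
    by (auto simp: compress_def)
  then show "linear (compress u f)"
    using linear_hyperplane_proj selfadjoint_linear[OF f] by (metis linear_compose)
qed (simp add: compress_def hyperplane_proj_inner selfadjoint_inner[OF f])

lemma inner_compress: "x \<bullet> compress u f x = hyperplane_proj u x \<bullet> f (hyperplane_proj u x)"
  by (simp add: compress_def flip: hyperplane_proj_inner)

lemma compress_self: "linear f \<Longrightarrow> compress u f u = 0"
  by (simp add: compress_def hyperplane_proj_self linear_0 linear_hyperplane_proj)

text \<open>The conditions on \<open>m\<close> characterise it as the largest eigenvalue of the
  compression: an attained bound for the Rayleigh quotient.\<close>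

locale top_compression =
  fixes f :: "'b::euclidean_space \<Rightarrow> 'b" and u :: 'b and m :: real
  assumes selfadjoint_f: "selfadjoint f" and u_nonzero: "u \<noteq> 0"
    and compress_le: "x \<bullet> compress u f x \<le> m * (x \<bullet> x)"
    and ex_top_eigenvector: "\<exists>x\<in>eigenspace (compress u f) m. x \<noteq> 0"
begin

text \<open>The compression annihilates \<open>u\<close>, so its form takes the value 0 at a nonzero
  vector.\<close>

lemma m_nonneg: "0 \<le> m"
proof -
  have "0 \<le> m * (u \<bullet> u)"
    using compress_le[of u] by (simp add: compress_self selfadjoint_linear[OF selfadjoint_f])
  moreover have "0 < u \<bullet> u" using u_nonzero by simp
  ultimately show ?thesis by (metis mult_neg_pos not_le)
qed

lemma form_le: "x \<bullet> u = 0 \<Longrightarrow> x \<bullet> f x \<le> m * (x \<bullet> x)"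
  using compress_le[of x] by (simp add: inner_compress hyperplane_proj_id)

text \<open>The part of the top eigenspace of the compression inside the hyperplane. It leaves out
  \<open>u\<close>, which lies in that eigenspace exactly when \<open>m = 0\<close>.\<close>

definition top_space :: "'b set" where
  "top_space = {x. x \<bullet> u = 0 \<and> hyperplane_proj u (f x) = m *\<^sub>R x}"

lemma top_space_form:
  assumes "x \<bullet> u = 0"
  shows "x \<in> top_space \<longleftrightarrow> x \<bullet> f x = m * (x \<bullet> x)"
proof
  assume "x \<in> top_space"
  then have "x \<bullet> hyperplane_proj u (f x) = m * (x \<bullet> x)" by (simp add: top_space_def)
  then show "x \<bullet> f x = m * (x \<bullet> x)" using assms by (simp add: hyperplane_proj_id flip: hyperplane_proj_inner)
next
  assume eq: "x \<bullet> f x = m * (x \<bullet> x)"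
  have "compress u f x = m *\<^sub>R x"
    by (rule form_bound_attained_imp_eigenvector[OF selfadjoint_compress[OF selfadjoint_f] compress_le])
      (simp add: eq inner_compress hyperplane_proj_id assms)
  then show "x \<in> top_space"
    using assms by (simp add: top_space_def compress_def hyperplane_proj_id)
qed

lemma subspace_top_space: "subspace top_space"
  using linear_hyperplane_proj[of u] selfadjoint_linear[OF selfadjoint_f]
  by (auto simp: subspace_def top_space_def inner_add_left linear_0 linear_add linear_scale scaleR_add_right)

text \<open>Values of the compression are orthogonal to \<open>u\<close>, hence so are eigenvectors
  for a nonzero eigenvalue.\<close>

lemma eigenspace_compress_pos:
  assumes "0 < m"
  shows "eigenspace (compress u f) m = top_space"
proof
  show "top_space \<subseteq> eigenspace (compress u f) m"
    by (auto simp: top_space_def eigenspace_def compress_def hyperplane_proj_id)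
  show "eigenspace (compress u f) m \<subseteq> top_space"
  proof
    fix x assume x: "x \<in> eigenspace (compress u f) m"
    then have "m * (x \<bullet> u) = compress u f x \<bullet> u" by (simp add: eigenspace_def)
    then have "x \<bullet> u = 0" using assms by (simp add: compress_def hyperplane_proj_perp)
    then show "x \<in> top_space"
      using x by (simp add: top_space_def eigenspace_def compress_def hyperplane_proj_id)
  qed
qed

text \<open>For \<open>m = 0\<close> the vector \<open>u\<close> adds to the eigenspace. This
  surplus is why the multiplicity condition rules out \<open>m = 0\<close>.\<close>

lemma dim_top_space_less:
  assumes "m = 0"
  shows "dim top_space < dim (eigenspace (compress u f) m)"
proof -
  have lin: "linear (compress u f)" using selfadjoint_compress selfadjoint_f selfadjoint_linear by blast
  have "u \<in> eigenspace (compress u f) m"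
    by (simp add: eigenspace_def assms compress_self selfadjoint_linear[OF selfadjoint_f])
  moreover have "u \<notin> top_space" using u_nonzero by (simp add: top_space_def)
  moreover have "top_space \<subseteq> eigenspace (compress u f) m"
    by (auto simp: top_space_def eigenspace_def compress_def hyperplane_proj_id)
  ultimately have "top_space \<subset> eigenspace (compress u f) m" by blast
  then show ?thesis
    using subspace_top_space subspace_eigenspace[OF lin] by (metis dim_psubset span_eq_iff)
qed

end

text \<open>Here \<open>l1\<close> and \<open>l2\<close> are the two largest eigenvalues of
  \<open>f\<close> counted with multiplicity, described through eigenspaces. For a graph,
  \<open>w\<close> will be a Perron vector.\<close>

locale compression_spectrum = top_compression +
  fixes l1 l2 :: real and w :: 'a
  assumes l2_le_l1: "l2 \<le> l1" and form_le_l1: "x \<bullet> f x \<le> l1 * (x \<bullet> x)"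
    and simple_l1: "l2 < l1 \<Longrightarrow> dim (eigenspace f l1) = 1"
    and double_l1: "l1 = l2 \<Longrightarrow> 2 \<le> dim (eigenspace f l1)"
    and ex_eigenvector_l2: "\<exists>x\<in>eigenspace f l2. x \<noteq> 0"
    and eigenvalue_gap: "x \<in> eigenspace f l \<Longrightarrow> x \<noteq> 0 \<Longrightarrow> l = l1 \<or> l \<le> l2"
    and w_eigenvector: "w \<in> eigenspace f l1" and w_not_perp: "w \<bullet> u \<noteq> 0"
begin

lemma subspace_eigenspace_f: "subspace (eigenspace f l)"
  using subspace_eigenspace selfadjoint_f selfadjoint_linear by blast

text \<open>One half of Cauchy interlacing: the span of two independent eigenvectors for
  \<open>l1\<close> and \<open>l2\<close> meets the hyperplane in a nonzero vector, whose Rayleigh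
  quotient is at least \<open>l2\<close>.\<close>

lemma interlacing: "l2 \<le> m"
proof -
  have "\<exists>x. x \<noteq> 0 \<and> x \<bullet> u = 0 \<and> l2 * (x \<bullet> x) \<le> x \<bullet> f x"
  proof (cases "l1 = l2")
    case True
    let ?C = "{x \<in> eigenspace f l1. x \<bullet> u = 0}"
    have "dim ?C + 1 = dim (eigenspace f l1)"
      using dim_Int_hyperplane[OF subspace_eigenspace_f w_eigenvector w_not_perp] .
    then have "dim ?C \<noteq> 0" using double_l1[OF True] by linarith
    then obtain x where "x \<in> ?C" "x \<noteq> 0" by auto
    then show ?thesis using True by (intro exI[of _ x]) (simp add: eigenspace_def)
  next
    case False
    obtain v where v: "v \<in> eigenspace f l2" "v \<noteq> 0" using ex_eigenvector_l2 by blast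
    have vw: "v \<bullet> w = 0" using eigenspaces_orthogonal[OF selfadjoint_f v(1) w_eigenvector] False by simp
    \<comment> \<open>Chosen to make \<open>v - c w\<close> orthogonal to \<open>u\<close>.\<close>
    define c where "c = (v \<bullet> u) / (w \<bullet> u)"
    let ?x = "v - c *\<^sub>R w"
    have "?x \<bullet> v = v \<bullet> v" using vw by (simp add: inner_diff_left inner_commute[of w v])
    then have "?x \<noteq> 0" using v(2) by auto
    moreover have "?x \<bullet> u = 0" using w_not_perp by (simp add: inner_diff_left c_def)
    moreover have "?x \<bullet> ?x = v \<bullet> v + c\<^sup>2 * (w \<bullet> w)"
      using vw by (simp add: inner_diff_left inner_diff_right inner_commute[of w v] power2_eq_square)
    moreover have "f ?x = l2 *\<^sub>R v - (c * l1) *\<^sub>R w"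
      using v(1) w_eigenvector selfadjoint_linear[OF selfadjoint_f]
      by (simp add: linear_diff linear_scale eigenspace_def)
    then have "?x \<bullet> f ?x = l2 * (v \<bullet> v) + l1 * (c\<^sup>2 * (w \<bullet> w))"
      using vw by (simp add: inner_diff_left inner_diff_right inner_commute[of w v] power2_eq_square)
    moreover have "l2 * (c\<^sup>2 * (w \<bullet> w)) \<le> l1 * (c\<^sup>2 * (w \<bullet> w))"
      using l2_le_l1 by (intro mult_right_mono) auto
    ultimately have "?x \<noteq> 0 \<and> ?x \<bullet> u = 0 \<and> l2 * (?x \<bullet> ?x) \<le> ?x \<bullet> f ?x"
      by (simp only: distrib_left) simp
    then show ?thesis by blast
  qed
  then obtain x where x: "x \<noteq> 0" "x \<bullet> u = 0" "l2 * (x \<bullet> x) \<le> x \<bullet> f x" by blast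
  then have "l2 * (x \<bullet> x) \<le> m * (x \<bullet> x)" using form_le[of x] by linarith
  then show ?thesis using x(1) by simp
qed

lemma eigenspace_perp_subset_top_space: "{x \<in> eigenspace f m. x \<bullet> u = 0} \<subseteq> top_space"
  by (auto simp: eigenspace_def top_space_form)

text \<open>If \<open>x\<close> were not orthogonal to \<open>u\<close>, some \<open>w - c x\<close>
  would lie in the hyperplane; its \<open>w\<close> component lifts its Rayleigh quotient strictly
  above \<open>l2\<close>, the maximum there.\<close>

lemma eigenspace_l2_perp:
  assumes "l2 < l1" "m = l2" "x \<in> eigenspace f l2"
  shows "x \<bullet> u = 0"
proof (rule ccontr)
  assume xu: "x \<bullet> u \<noteq> 0"
  have xw: "x \<bullet> w = 0"
    using eigenspaces_orthogonal[OF selfadjoint_f assms(3) w_eigenvector] assms(1) by simp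
  define c where "c = (w \<bullet> u) / (x \<bullet> u)"
  let ?y = "w - c *\<^sub>R x"
  have "?y \<bullet> u = 0" using xu by (simp add: inner_diff_left c_def)
  then have "?y \<bullet> f ?y \<le> l2 * (?y \<bullet> ?y)" using form_le assms by blast
  moreover have "?y \<bullet> ?y = w \<bullet> w + c\<^sup>2 * (x \<bullet> x)"
    using xw by (simp add: inner_diff_left inner_diff_right inner_commute[of w x] power2_eq_square)
  moreover have "f ?y = l1 *\<^sub>R w - (c * l2) *\<^sub>R x"
    using assms(3) w_eigenvector selfadjoint_linear[OF selfadjoint_f]
    by (simp add: linear_diff linear_scale eigenspace_def)
  then have "?y \<bullet> f ?y = l1 * (w \<bullet> w) + l2 * (c\<^sup>2 * (x \<bullet> x))"
    using xw by (simp add: inner_diff_left inner_diff_right inner_commute[of w x] power2_eq_square)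
  ultimately have "l1 * (w \<bullet> w) + l2 * (c\<^sup>2 * (x \<bullet> x)) \<le> l2 * (w \<bullet> w + c\<^sup>2 * (x \<bullet> x))" by simp
  then have "l1 * (w \<bullet> w) \<le> l2 * (w \<bullet> w)" by (simp add: distrib_left)
  moreover have "w \<noteq> 0" using w_not_perp by auto
  ultimately show False using assms(1) by simp
qed

text \<open>If \<open>l1 = l2\<close>, the top space is the hyperplane section of the eigenspace,
  and the subtracted 1 is the dimension lost. Otherwise the eigenspace lies in the top space, and
  equal dimensions mean equal spaces.\<close>

lemma top_space_multiplicity:
  assumes m: "m = l2"
  defines "k \<equiv> dim (eigenspace f l2) - (if l1 = l2 then 1 else 0)"
  shows "k \<le> dim top_space" "k = dim top_space \<longleftrightarrow> top_space \<subseteq> eigenspace f l2"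
proof -
  have "k \<le> dim top_space \<and> (k = dim top_space \<longleftrightarrow> top_space \<subseteq> eigenspace f l2)"
  proof (cases "l1 = l2")
    case True
    have sub: "top_space \<subseteq> eigenspace f l2"
    proof
      fix x assume "x \<in> top_space"
      then have "x \<bullet> f x = l1 * (x \<bullet> x)"
        using top_space_form[of x] unfolding True m[symmetric] by (simp add: top_space_def)
      \<comment> \<open>Here \<open>m\<close> is also the maximum of the form on the whole
        space.\<close>
      then have "f x = l1 *\<^sub>R x"
        by (rule form_bound_attained_imp_eigenvector[OF selfadjoint_f form_le_l1])
      then show "x \<in> eigenspace f l2" using True by (simp add: eigenspace_def)
    qed
    moreover have "top_space \<subseteq> {x. x \<bullet> u = 0}" by (auto simp: top_space_def)
    ultimately have "top_space = {x \<in> eigenspace f l2. x \<bullet> u = 0}"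
      using eigenspace_perp_subset_top_space m by blast
    then have "dim top_space + 1 = dim (eigenspace f l2)"
      using dim_Int_hyperplane[OF subspace_eigenspace_f w_eigenvector w_not_perp] True by simp
    then have "k = dim top_space" using True by (simp add: k_def)
    then show ?thesis using sub by simp
  next
    case False
    then have "l2 < l1" using l2_le_l1 by simp
    then have sub: "eigenspace f l2 \<subseteq> top_space"
      using eigenspace_l2_perp m eigenspace_perp_subset_top_space by blast
    then have "dim (eigenspace f l2) \<le> dim top_space" by (rule dim_subset)
    moreover have "dim (eigenspace f l2) = dim top_space \<longleftrightarrow> top_space \<subseteq> eigenspace f l2"
      using subspace_dim_equal[OF subspace_eigenspace_f subspace_top_space sub] sub by auto
    ultimately show ?thesis using False by (simp add: k_def)
  qed
  then show "k \<le> dim top_space" "k = dim top_space \<longleftrightarrow> top_space \<subseteq> eigenspace f l2" by auto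
qed

theorem top_eigenspace_subset_iff:
  "0 < m \<and> eigenspace (compress u f) m \<subseteq> eigenspace f m \<longleftrightarrow>
   m = l2 \<and> dim (eigenspace f l2) - (if l1 = l2 then 1 else 0) = dim (eigenspace (compress u f) l2)"
    (is "?L \<longleftrightarrow> ?R")
proof
  assume L: ?L
  obtain v where v: "v \<in> top_space" "v \<noteq> 0" "v \<in> eigenspace f m"
    using ex_top_eigenvector L eigenspace_compress_pos by blast
  \<comment> \<open>A larger \<open>m\<close> would be the simple eigenvalue \<open>l1\<close>,
    whose eigenline is spanned by \<open>w\<close> and so contains no nonzero vector orthogonal to
    \<open>u\<close>, such as \<open>v\<close>.\<close>
  have "m = l2"
  proof (rule ccontr)
    assume "m \<noteq> l2"
    then have gt: "l2 < m" using interlacing by simp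
    then have m: "m = l1" using eigenvalue_gap v by force
    then have "dim (eigenspace f l1) = 1" using simple_l1 gt by simp
    then have "dim {x \<in> eigenspace f l1. x \<bullet> u = 0} = 0"
      using dim_Int_hyperplane[OF subspace_eigenspace_f w_eigenvector w_not_perp] by simp
    moreover have "v \<bullet> u = 0" using v(1) by (simp add: top_space_def)
    ultimately show False using v(2,3) m by auto
  qed
  then show ?R using L top_space_multiplicity(2) eigenspace_compress_pos by auto
next
  assume R: ?R
  have "0 < m"
  proof (rule ccontr)
    assume "\<not> 0 < m"
    then have "m = 0" using m_nonneg by simp
    \<comment> \<open>The corrected multiplicity is at most the dimension of the top space, which is
      strictly below that of the compressed eigenspace.\<close>
    then show False using dim_top_space_less top_space_multiplicity(1) R by simp
  qed
  then show ?L using R top_space_multiplicity(2) eigenspace_compress_pos by auto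
qed

end

section \<open>The adjacency operator\<close>

context basis_enumeration
begin

lemma One_inner_One: "(One::'b) \<bullet> One = real n"
  by (subst inner_One) (simp add: One_inner_b)

lemma mat_op_proj_mat: "mat_op (proj_mat n) = hyperplane_proj One"
proof
  fix x
  show "mat_op (proj_mat n) x = hyperplane_proj One x"
  proof (rule eqI)
    fix i assume i: "i < n"
    have "mat_op (proj_mat n) x \<bullet> b i = (\<Sum>j<n. (if i = j then x \<bullet> b j else 0) - (x \<bullet> b j) / n)"
      using i by (subst mat_op_inner) (auto intro!: sum.cong simp: proj_mat_def ones_mat_def left_diff_distrib)
    also have "\<dots> = x \<bullet> b i - (x \<bullet> One) / n"
      using i by (simp add: sum_subtractf inner_One sum_divide_distrib)
    also have "\<dots> = hyperplane_proj One x \<bullet> b i"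
      using i by (simp add: hyperplane_proj_def inner_diff_left One_inner_b One_inner_One)
    finally show "mat_op (proj_mat n) x \<bullet> b i = hyperplane_proj One x \<bullet> b i" .
  qed
qed

end

locale graph_operator = basis_enumeration n b for n and b :: "nat \<Rightarrow> 'b::euclidean_space" +
  fixes E :: "nat \<Rightarrow> nat \<Rightarrow> bool"
  assumes graph: "simple_graph n E" and two_le_n: "2 \<le> n"
begin

abbreviation A where "A \<equiv> adj_mat n E"
abbreviation M where "M \<equiv> proj_mat n * A * proj_mat n"
abbreviation f where "f \<equiv> mat_op A"
abbreviation g where "g \<equiv> compress One f"

lemma carrier: "A \<in> carrier_mat n n" "proj_mat n \<in> carrier_mat n n" "M \<in> carrier_mat n n"
  by (auto simp: adj_mat_def proj_mat_def ones_mat_def)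

lemma adj_index: "i < n \<Longrightarrow> j < n \<Longrightarrow> A $$ (i, j) = (if E i j then 1 else 0)"
  by (simp add: adj_mat_def)

lemma E_sym: "E i j \<longleftrightarrow> E j i" and E_irrefl: "\<not> E i i"
  using graph by (auto simp: simple_graph_def)

lemma selfadjoint_f: "selfadjoint f"
  using E_sym by (intro selfadjoint_mat_op) (auto simp: adj_index)

lemma mat_op_M: "mat_op M = g"
  by (rule ext) (simp add: mat_op_mult carrier mat_op_proj_mat compress_def mult_carrier_mat[of _ n n _ n])

lemma selfadjoint_g: "selfadjoint g"
  by (rule selfadjoint_compress[OF selfadjoint_f])

lemma One_nonzero: "(One::'b) \<noteq> 0"
  by simp

section \<open>Spectral data of the adjacency matrix and of its compression\<close>

lemma eig_mult_A: "eig_mult A l = dim (eigenspace f l)"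
  by (rule eig_mult_eq_dim_eigenspace[OF carrier(1) selfadjoint_f])

lemma eig_mult_M: "eig_mult M l = dim (eigenspace g l)"
  using eig_mult_eq_dim_eigenspace[OF carrier(3)] selfadjoint_g by (simp add: mat_op_M)

lemma UNIV_nontrivial: "(UNIV :: 'b set) \<noteq> {0}"
  using One_nonzero by blast

lemma top_compression_max_eigenvalue: "top_compression f One (max_eigenvalue M)"
proof -
  obtain v l where v: "norm v = 1" "g v = l *\<^sub>R v" and le: "\<And>x. x \<bullet> g x \<le> l * (x \<bullet> x)"
    using selfadjoint_top_eigenvector[OF selfadjoint_g subspace_UNIV _ UNIV_nontrivial] by auto
  have ev: "eigenvalue M k \<longleftrightarrow> (\<exists>x\<in>eigenspace g k. x \<noteq> 0)" for k
    using eigenvalue_iff_eigenspace[OF carrier(3)] by (simp add: mat_op_M)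
  have vl: "v \<in> eigenspace g l" "v \<noteq> 0" using v by (auto simp: eigenspace_def)
  have "max_eigenvalue M = l"
    unfolding max_eigenvalue_def
  proof (rule Max_eqI)
    have "char_poly M \<noteq> 0" using degree_monic_char_poly[OF carrier(3)] by auto
    then show "finite {x. eigenvalue M x}"
      by (simp add: eigenvalue_root_char_poly[OF carrier(3)] poly_roots_finite)
    show "l \<in> {x. eigenvalue M x}" using ev vl by blast
  next
    fix k assume "k \<in> {x. eigenvalue M x}"
    then obtain x where "x \<in> eigenspace g k" "x \<noteq> 0" using ev by blast
    then show "k \<le> l" using le[of x] by (simp add: eigenspace_def)
  qed
  then show ?thesis
    using selfadjoint_f One_nonzero le vl by unfold_locales auto
qed

text \<open>Taking absolute values of the coordinates keeps the norm and, as \<open>A\<close> has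
  nonnegative entries, does not decrease the form. The result is again extremal, hence an
  eigenvector, and its coordinate sum is positive. The graph may be disconnected.\<close>

lemma perron_vector:
  assumes le: "\<And>x. x \<bullet> f x \<le> l * (x \<bullet> x)" and x: "x \<in> eigenspace f l" "x \<noteq> 0"
  obtains w where "w \<in> eigenspace f l" "w \<bullet> One \<noteq> 0"
proof -
  define w where "w = (\<Sum>i<n. \<bar>x \<bullet> b i\<bar> *\<^sub>R b i)"
  have wi: "w \<bullet> b i = \<bar>x \<bullet> b i\<bar>" if "i < n" for i
    using inner_sum_b[OF that] by (simp add: w_def)
  have ww: "w \<bullet> w = x \<bullet> x"
    unfolding inner_expand[of w w] inner_expand[of x x] by (intro sum.cong) (auto simp: wi)
  have form: "y \<bullet> f y = (\<Sum>i<n. \<Sum>j<n. (y \<bullet> b i) * (A $$ (i, j) * (y \<bullet> b j)))" for y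
    by (subst inner_expand) (simp add: mat_op_inner sum_distrib_left)
  have "l * (w \<bullet> w) = x \<bullet> f x" using x by (simp add: eigenspace_def ww)
  also have "\<dots> \<le> w \<bullet> f w"
    unfolding form
  proof (intro sum_mono)
    fix i j assume ij: "i \<in> {..<n}" "j \<in> {..<n}"
    have "(x \<bullet> b i) * (x \<bullet> b j) \<le> \<bar>x \<bullet> b i\<bar> * \<bar>x \<bullet> b j\<bar>"
      by (metis abs_ge_self abs_mult)
    then show "(x \<bullet> b i) * (A $$ (i, j) * (x \<bullet> b j)) \<le> (w \<bullet> b i) * (A $$ (i, j) * (w \<bullet> b j))"
      using ij by (simp add: adj_index wi)
  qed
  finally have "w \<bullet> f w = l * (w \<bullet> w)" using le[of w] by simp
  then have "w \<in> eigenspace f l"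
    using form_bound_attained_imp_eigenvector[OF selfadjoint_f le] by (simp add: eigenspace_def)
  moreover have "w \<bullet> One \<noteq> 0"
  proof
    assume "w \<bullet> One = 0"
    then have "(\<Sum>i<n. \<bar>x \<bullet> b i\<bar>) = 0" by (simp add: inner_One wi)
    then have "x \<bullet> b i = 0 \<bullet> b i" if "i < n" for i using that by (simp add: sum_nonneg_eq_0_iff)
    then show False using x(2) eqI by blast
  qed
  ultimately show ?thesis using that by blast
qed

lemma dim_eigenspace_eq_card:
  assumes "char_poly A = (\<Prod>i<n. [:- (lam ! i), 1:])"
  shows "dim (eigenspace f l) = card {i. i < n \<and> lam ! i = l}"
proof -
  have "dim (eigenspace f l) = order l (\<Prod>a\<leftarrow>map ((!) lam) [0..<n]. [:- a, 1:])"
    by (simp add: assms eig_mult_def prod.list_conv_set_nth atLeast0LessThan flip: eig_mult_A)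
  also have "\<dots> = (\<Sum>a\<leftarrow>map ((!) lam) [0..<n]. order l [:- a, 1:])"
    by (subst order_prod_list) (auto simp: o_def)
  also have "\<dots> = (\<Sum>j<n. order l [:- (lam ! j), 1:])"
    by (simp add: interv_sum_list_conv_sum_set_nat atLeast0LessThan o_def)
  also have "\<dots> = (\<Sum>j<n. if lam ! j = l then 1 else 0)"
    by (intro sum.cong refl) (auto simp: order_linear' order_linear)
  also have "\<dots> = card {i. i < n \<and> lam ! i = l}"
    by (simp add: sum.If_cases Int_def)
  finally show ?thesis .
qed

lemma compression_spectrum_adjacency:
  assumes lam: "length lam = n" "sorted_wrt (\<ge>) lam" "char_poly A = (\<Prod>i<n. [:- (lam ! i), 1:])"
  obtains w where "compression_spectrum f One (max_eigenvalue M) (lam ! 0) (lam ! 1) w"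
proof -
  note card = dim_eigenspace_eq_card[OF lam(3)]
  have ne: "\<exists>x\<in>eigenspace f (lam ! i). x \<noteq> 0" if "i < n" for i
  proof -
    have "dim (eigenspace f (lam ! i)) \<noteq> 0" using that by (auto simp: card)
    then show ?thesis by auto
  qed
  have ex: "\<exists>i<n. lam ! i = l" if "x \<in> eigenspace f l" "x \<noteq> 0" for x l
  proof -
    have "dim (eigenspace f l) \<noteq> 0" using that by auto
    then show ?thesis by (auto simp: card card_eq_0_iff)
  qed
  have mono: "lam ! j \<le> lam ! i" if "i \<le> j" "j < n" for i j
    using lam(1,2) that by (cases "i = j") (auto simp: sorted_wrt_iff_nth_less)
  obtain v l where v: "norm v = 1" "f v = l *\<^sub>R v" and le: "\<And>x. x \<bullet> f x \<le> l * (x \<bullet> x)"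
    using selfadjoint_top_eigenvector[OF selfadjoint_f subspace_UNIV _ UNIV_nontrivial] by auto
  have "v \<in> eigenspace f l" "v \<noteq> 0" using v by (auto simp: eigenspace_def)
  then obtain i where i: "i < n" "lam ! i = l" using ex by blast
  \<comment> \<open>The maximum of the form is an eigenvalue, hence an entry of the decreasing
    list.\<close>
  then have l: "l \<le> lam ! 0" using mono[of 0 i] by simp
  have le0: "x \<bullet> f x \<le> lam ! 0 * (x \<bullet> x)" for x
    using le[of x] mult_right_mono[OF l, of "x \<bullet> x"] by simp
  obtain x where "x \<in> eigenspace f (lam ! 0)" "x \<noteq> 0" using ne[of 0] two_le_n by auto
  then obtain w where w: "w \<in> eigenspace f (lam ! 0)" "w \<bullet> One \<noteq> 0"
    using perron_vector[OF le0] by blast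
  interpret top_compression f One "max_eigenvalue M" by (rule top_compression_max_eigenvalue)
  have "compression_spectrum f One (max_eigenvalue M) (lam ! 0) (lam ! 1) w"
  proof
    show "lam ! 1 \<le> lam ! 0" using mono[of 0 1] two_le_n by simp
    show "\<exists>x\<in>eigenspace f (lam ! 1). x \<noteq> 0" using ne[of 1] two_le_n by simp
    show "dim (eigenspace f (lam ! 0)) = 1" if "lam ! 1 < lam ! 0"
    proof -
      have "{i. i < n \<and> lam ! i = lam ! 0} = {0}"
      proof (intro equalityI subsetI)
        fix i assume "i \<in> {i. i < n \<and> lam ! i = lam ! 0}"
        then show "i \<in> {0}" using mono[of 1 i] that by (cases "i = 0") auto
      qed (use two_le_n in auto)
      then show ?thesis by (simp add: card)
    qed
    show "2 \<le> dim (eigenspace f (lam ! 0))" if "lam ! 0 = lam ! 1"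
    proof -
      have "card {0, 1::nat} \<le> card {i. i < n \<and> lam ! i = lam ! 0}"
        using that two_le_n by (intro card_mono) auto
      then show ?thesis by (simp add: card)
    qed
    show "l = lam ! 0 \<or> l \<le> lam ! 1" if x: "x \<in> eigenspace f l" "x \<noteq> 0" for x l
    proof -
      obtain i where "i < n" "lam ! i = l" using ex[OF x] by blast
      then show ?thesis using mono[of 1 i] by (cases "i = 0") auto
    qed
  qed (use le0 w in auto)
  then show ?thesis using that by blast
qed

end

section \<open>Spherical representations\<close>

context graph_operator
begin

lemma spherical_rep_imp_top_eigenspace_subset:
  assumes top: "top_compression f One m" and dim: "DIM('a::euclidean_space) + 2 = n"
    and rep: "spherical_rep TYPE('a) n E"
  shows "0 < m \<and> eigenspace g m \<subseteq> eigenspace f m"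
proof -
  interpret top_compression f One m by (rule top)
  obtain p :: "nat \<Rightarrow> 'a" and a1 a2 c r where p: "two_distance_rep n E p a1 a2"
    and sphere: "\<And>i. i < n \<Longrightarrow> dist (p i) c = r"
    using rep unfolding spherical_rep_def by blast
  have inj: "inj_on p {0..<n}" and a12: "a2 < a1"
    and dists: "{dist (p i) (p j) | i j. i < n \<and> j < n \<and> i \<noteq> j} = {a1, a2}"
    and adj: "\<And>i j. i < n \<Longrightarrow> j < n \<Longrightarrow> i \<noteq> j \<Longrightarrow> E i j \<longleftrightarrow> dist (p i) (p j) = a1"
    using p by (auto simp: two_distance_rep_def)
  have "a2 \<in> {dist (p i) (p j) | i j. i < n \<and> j < n \<and> i \<noteq> j}" using dists by blast
  then obtain i j where "i < n" "j < n" "i \<noteq> j" "a2 = dist (p i) (p j)" by blast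
  then have a2: "0 < a2" using inj by (auto simp: inj_on_def)
  define k where "k = a1\<^sup>2 - a2\<^sup>2"
  have k: "0 < k" using a2 a12 by (simp add: k_def power_strict_mono)
  \<comment> \<open>With the centre at the origin all \<open>q i\<close> have norm \<open>r\<close>,
    so a squared distance is \<open>2 * r\<^sup>2\<close> minus twice an inner product.\<close>
  define q where "q i = p i - c" for i
  define T where "T x = (\<Sum>i<n. (x \<bullet> b i) *\<^sub>R q i)" for x
  have linT: "linear T"
    by (intro linearI) (simp_all add: T_def inner_add_left scaleR_add_left sum.distrib scaleR_sum_right)
  \<comment> \<open>Entrywise, the matrix of squared distances is
    \<open>a2\<^sup>2 (J - I) + k A\<close>.\<close>
  have D: "2 * r\<^sup>2 - 2 * (q i \<bullet> q j) = a2\<^sup>2 - a2\<^sup>2 * (if i = j then 1 else 0) + k * A $$ (i, j)"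
    if ij: "i < n" "j < n" for i j
  proof -
    have qq: "q i \<bullet> q i = r\<^sup>2" if "i < n" for i
      using sphere[OF that] by (simp add: q_def dist_norm flip: power2_norm_eq_inner)
    have "2 * r\<^sup>2 - 2 * (q i \<bullet> q j) = (dist (p i) (p j))\<^sup>2"
      using qq[of i] qq[of j] ij
      by (simp add: q_def dist_norm power2_norm_eq_inner inner_diff_left inner_diff_right inner_commute)
    moreover have "dist (p i) (p j) = (if E i j then a1 else a2)" if "i \<noteq> j"
    proof -
      have "dist (p i) (p j) \<in> {a1, a2}" using dists ij that by blast
      then show ?thesis using adj[OF ij that] by auto
    qed
    ultimately show ?thesis using ij by (cases "i = j") (auto simp: adj_index E_irrefl k_def)
  qed
  \<comment> \<open>Summation against \<open>x\<close> removes the constants. The sphere yields this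
    identity for each coordinate, not merely for the quadratic form.\<close>
  have key: "k * (f x \<bullet> b i) = a2\<^sup>2 * (x \<bullet> b i) - 2 * (q i \<bullet> T x)" if x: "x \<bullet> One = 0" and i: "i < n" for x i
  proof -
    have s0: "(\<Sum>j<n. x \<bullet> b j) = 0" using x by (simp add: inner_One)
    have "(\<Sum>j<n. (x \<bullet> b j) * (2 * r\<^sup>2 - 2 * (q i \<bullet> q j))) =
        2 * r\<^sup>2 * (\<Sum>j<n. x \<bullet> b j) - 2 * (q i \<bullet> T x)"
      by (simp add: T_def inner_sum_right right_diff_distrib sum_subtractf sum_distrib_left mult_ac)
    moreover have "(\<Sum>j<n. (x \<bullet> b j) * (2 * r\<^sup>2 - 2 * (q i \<bullet> q j))) =
        (\<Sum>j<n. a2\<^sup>2 * (x \<bullet> b j) - (if i = j then a2\<^sup>2 * (x \<bullet> b j) else 0) + k * (A $$ (i, j) * (x \<bullet> b j)))"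
      by (intro sum.cong refl) (simp add: D[OF i], simp add: algebra_simps)
    moreover have "\<dots> = a2\<^sup>2 * (\<Sum>j<n. x \<bullet> b j) - a2\<^sup>2 * (x \<bullet> b i) + k * (f x \<bullet> b i)"
      using i by (simp add: sum.distrib sum_subtractf mat_op_inner sum_distrib_left)
    ultimately show ?thesis using s0 by simp
  qed
  have form: "k * (x \<bullet> f x) = a2\<^sup>2 * (x \<bullet> x) - 2 * (T x \<bullet> T x)" if x: "x \<bullet> One = 0" for x
  proof -
    have "k * (x \<bullet> f x) = (\<Sum>i<n. (x \<bullet> b i) * (k * (f x \<bullet> b i)))"
      by (subst inner_expand) (simp add: sum_distrib_left mult_ac)
    also have "\<dots> = (\<Sum>i<n. a2\<^sup>2 * ((x \<bullet> b i) * (x \<bullet> b i)) - 2 * ((x \<bullet> b i) * (q i \<bullet> T x)))"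
      by (intro sum.cong refl) (simp add: key[OF x] algebra_simps)
    also have "\<dots> = a2\<^sup>2 * (x \<bullet> x) - 2 * ((\<Sum>i<n. (x \<bullet> b i) *\<^sub>R q i) \<bullet> T x)"
      by (simp add: sum_subtractf inner_expand[of x x] inner_sum_left sum_distrib_left)
    finally show ?thesis by (simp add: T_def)
  qed
  \<comment> \<open>The kernel of \<open>L\<close> consists of the affine dependencies; it is
    nonzero because the target has dimension \<open>n - 1\<close>.\<close>
  define L :: "'b \<Rightarrow> 'a \<times> real" where "L x = (T x, x \<bullet> One)" for x
  have linL: "linear L"
    by (intro linearI) (auto simp: L_def linear_add[OF linT] linear_scale[OF linT] inner_add_left)
  have "\<not> inj L"
  proof
    assume "inj L"
    then have "dim (range L) = DIM('b)" using dim_image_eq[OF linL, of UNIV] by simp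
    then show False using dim_subset_UNIV[of "range L"] dim DIM_eq by simp
  qed
  then obtain x0 where x0: "L x0 = 0" "x0 \<noteq> 0" using linear_injective_0[OF linL] by blast
  have x0': "x0 \<bullet> One = 0" "T x0 = 0" using x0(1) by (auto simp: L_def zero_prod_def)
  have "a2\<^sup>2 * (x0 \<bullet> x0) \<le> k * (m * (x0 \<bullet> x0))"
    using form[OF x0'(1)] mult_left_mono[OF form_le[OF x0'(1)], of k] k x0'(2) by simp
  then have ge: "a2\<^sup>2 \<le> k * m" using x0(2) by (simp flip: mult.assoc)
  then have m: "0 < m" using a2 k by (smt (verit) zero_less_power zero_less_mult_pos)
  obtain v where v: "v \<in> top_space" "v \<noteq> 0"
    using ex_top_eigenvector eigenspace_compress_pos[OF m] by blast
  then have vu: "v \<bullet> One = 0" by (simp add: top_space_def)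
  \<comment> \<open>The dependency \<open>x0\<close> bounds \<open>k * m\<close> from below; a top
    vector bounds it from above, as the squared norm of \<open>T v\<close> is nonnegative.\<close>
  have "k * (m * (v \<bullet> v)) \<le> a2\<^sup>2 * (v \<bullet> v)"
    using form[OF vu] top_space_form[OF vu] v(1) by simp
  then have "k * m \<le> a2\<^sup>2" using v(2) by (simp flip: mult.assoc)
  then have km: "a2\<^sup>2 = k * m" using ge by simp
  have "eigenspace g m \<subseteq> eigenspace f m"
  proof
    fix x assume "x \<in> eigenspace g m"
    then have x: "x \<in> top_space" by (simp add: eigenspace_compress_pos[OF m])
    then have xu: "x \<bullet> One = 0" by (simp add: top_space_def)
    \<comment> \<open>So top vectors are affine dependencies, and for these \<open>key\<close>
      becomes the eigenvector equation for \<open>f\<close>.\<close>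
    have "T x = 0" using form[OF xu] top_space_form[OF xu] x km by simp
    then have "f x \<bullet> b i = (m *\<^sub>R x) \<bullet> b i" if "i < n" for i
      using key[OF xu that] km k by simp
    then show "x \<in> eigenspace f m" using eqI by (auto simp: eigenspace_def)
  qed
  then show ?thesis using m by simp
qed

text \<open>The compression of \<open>m I - A\<close> is positive semidefinite of rank at most
  \<open>n - 2\<close>, since \<open>One\<close> and a top vector lie in its kernel. Its Gram
  vectors are the points; the inclusion of eigenspaces yields the centre.\<close>

lemma top_eigenspace_subset_imp_spherical_rep:
  assumes top: "top_compression f One m" and dim: "DIM('a::euclidean_space) + 2 = n"
    and m: "0 < m" and sub: "eigenspace g m \<subseteq> eigenspace f m"
  shows "spherical_rep TYPE('a) n E"
proof -
  interpret top_compression f One m by (rule top)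
  let ?P = "hyperplane_proj (One::'b)"
  define h where "h x = m *\<^sub>R x - f x" for x
  define G where "G = compress One h"
  have h: "selfadjoint h" unfolding h_def[abs_def] by (rule selfadjoint_shift[OF selfadjoint_f])
  have G: "selfadjoint G" unfolding G_def by (rule selfadjoint_compress[OF h])
  note lin = selfadjoint_linear[OF h] selfadjoint_linear[OF G]
  have xGx: "x \<bullet> G x = m * (?P x \<bullet> ?P x) - ?P x \<bullet> f (?P x)" for x
    by (simp add: G_def inner_compress h_def inner_diff_right)
  have nonneg: "0 \<le> x \<bullet> G x" for x
    using form_le[OF hyperplane_proj_perp, of x] by (simp add: xGx)
  obtain v where v: "v \<in> top_space" "v \<noteq> 0" "v \<in> eigenspace f m"
    using ex_top_eigenvector eigenspace_compress_pos[OF m] sub by blast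
  have vu: "v \<bullet> One = 0" using v(1) by (simp add: top_space_def)
  have "G v = 0"
    using v(3) vu by (simp add: G_def compress_def hyperplane_proj_id h_def eigenspace_def
        linear_0[OF linear_hyperplane_proj])
  then have "v \<in> {x \<in> eigenspace G 0. x \<bullet> One = 0}" using vu by (simp add: eigenspace_def)
  then have "dim {x \<in> eigenspace G 0. x \<bullet> One = 0} \<noteq> 0" using v(2) by auto
  moreover have "dim {x \<in> eigenspace G 0. x \<bullet> One = 0} + 1 = dim (eigenspace G 0)"
    using One_inner_One two_le_n
    by (intro dim_Int_hyperplane[of _ One] subspace_eigenspace lin)
      (auto simp: eigenspace_def G_def compress_self[OF lin(1)])
  ultimately have "DIM('b) \<le> dim (eigenspace G 0) + DIM('a)"
    using dim DIM_eq by linarith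
  from nonneg_selfadjoint_factor[OF G nonneg this]
  obtain T :: "'b \<Rightarrow> 'a" where T: "linear T" "\<And>x y. T x \<bullet> T y = x \<bullet> G y" by blast
  define p where "p i = T (b i)" for i
  have fb: "f (b j) \<bullet> b i = A $$ (i, j)" if "i < n" "j < n" for i j
    using that by (simp add: mat_op_inner inner_b if_distrib[of "(*) _"] cong: if_cong)
  \<comment> \<open>The difference \<open>b i - b j\<close> is orthogonal to \<open>One\<close>, so
    the projection leaves it fixed and the form of \<open>m I - A\<close> can be evaluated
    directly.\<close>
  have dist: "(dist (p i) (p j))\<^sup>2 = (if E i j then 2 * m + 2 else 2 * m)"
    if ij: "i < n" "j < n" "i \<noteq> j" for i j
  proof -
    let ?z = "b i - b j"
    have zu: "?z \<bullet> One = 0"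
      using One_inner_b ij by (simp add: inner_diff_left inner_commute[of "b _" One])
    have "(dist (p i) (p j))\<^sup>2 = T ?z \<bullet> T ?z"
      by (simp add: p_def dist_norm power2_norm_eq_inner linear_diff[OF T(1)])
    also have "\<dots> = m * (?z \<bullet> ?z) - ?z \<bullet> f ?z"
      by (simp add: T(2) xGx hyperplane_proj_id[OF zu])
    also have "?z \<bullet> ?z = 2" using ij by (simp add: inner_diff_left inner_diff_right inner_b)
    also have "?z \<bullet> f ?z = - 2 * A $$ (i, j)"
      using ij E_irrefl E_sym[of j i]
      by (simp add: linear_diff[OF linear_mat_op] inner_diff_left inner_diff_right
          inner_commute[of "b _" "f _"] fb adj_index)
    finally show ?thesis using ij by (simp add: adj_index)
  qed
  define a1 where "a1 = sqrt (2 * m + 2)"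
  define a2 where "a2 = sqrt (2 * m)"
  have a12: "0 < a2" "a2 < a1" using m by (auto simp: a1_def a2_def)
  have dist': "dist (p i) (p j) = (if E i j then a1 else a2)"
    if ij: "i < n" "j < n" "i \<noteq> j" for i j
    using dist[OF ij] by (auto simp: a1_def a2_def intro!: real_sqrt_unique[symmetric])
  have inj: "inj_on p {0..<n}"
  proof (rule inj_onI, rule ccontr)
    fix i j assume "i \<in> {0..<n}" "j \<in> {0..<n}" "p i = p j" "i \<noteq> j"
    then show False using dist'[of i j] a12 by (auto split: if_splits)
  qed
  \<comment> \<open>Both distances must occur. Without edges \<open>A = 0\<close>, so
    \<open>m > 0\<close> could not be an eigenvalue.\<close>
  have edge: "\<exists>i j. i < n \<and> j < n \<and> i \<noteq> j \<and> E i j"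
  proof (rule ccontr)
    assume none: "\<not> ?thesis"
    have "f v \<bullet> b i = 0 \<bullet> b i" if "i < n" for i
    proof -
      have "\<not> E i j" if "j < n" for j using none \<open>i < n\<close> that E_irrefl by (cases "i = j") auto
      then show ?thesis using that by (simp add: mat_op_inner adj_index)
    qed
    then have "f v = 0" by (rule eqI)
    then show False using v m by (simp add: eigenspace_def)
  qed
  \<comment> \<open>For a complete graph \<open>A = J - I\<close> acts as -1 on the hyperplane,
    again contradicting \<open>m > 0\<close>.\<close>
  have non_edge: "\<exists>i j. i < n \<and> j < n \<and> i \<noteq> j \<and> \<not> E i j"
  proof (rule ccontr)
    assume none: "\<not> ?thesis"
    have "f v \<bullet> b i = (- v) \<bullet> b i" if i: "i < n" for i
    proof -
      have "f v \<bullet> b i = (\<Sum>j<n. v \<bullet> b j - (if i = j then v \<bullet> b j else 0))"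
        unfolding mat_op_inner[OF i]
        using none i E_irrefl by (intro sum.cong refl) (auto simp: adj_index)
      also have "\<dots> = v \<bullet> One - v \<bullet> b i"
        using i by (simp add: sum_subtractf inner_One)
      finally show ?thesis using vu by simp
    qed
    then have "f v = - v" by (rule eqI)
    then have "v \<bullet> f v = - (v \<bullet> v)" by simp
    moreover have "v \<bullet> f v = m * (v \<bullet> v)" using top_space_form[OF vu] v(1) by blast
    ultimately have "(m + 1) * (v \<bullet> v) = 0" by (simp add: distrib_right)
    then show False using v(2) m by simp
  qed
  have "two_distance_rep n E p a1 a2"
    unfolding two_distance_rep_def
  proof (intro conjI allI impI)
    show "{dist (p i) (p j) | i j. i < n \<and> j < n \<and> i \<noteq> j} = {a1, a2}" (is "?D = _")
    proof
      show "?D \<subseteq> {a1, a2}" using dist' by auto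
      have "a1 \<in> ?D" using edge dist' by (smt (verit) mem_Collect_eq)
      moreover have "a2 \<in> ?D" using non_edge dist' by (smt (verit) mem_Collect_eq)
      ultimately show "{a1, a2} \<subseteq> ?D" by blast
    qed
  qed (use inj a12 dist' in auto)
  \<comment> \<open>The linear system for the centre. If \<open>G x = 0\<close>, the projection of
    \<open>x\<close> is a top vector, so by inclusion \<open>h\<close> kills it and the right-hand
    side is orthogonal to \<open>x\<close>.\<close>
  moreover have "\<exists>y. G y = ?P (h One)"
  proof -
    have "?P (h One) \<in> range G"
    proof (rule selfadjoint_range[OF G])
      fix x assume "G x = 0"
      then have "?P x \<bullet> f (?P x) = m * (?P x \<bullet> ?P x)" using xGx[of x] by simp
      then have "?P x \<in> eigenspace f m"
        using top_space_form[OF hyperplane_proj_perp] eigenspace_compress_pos[OF m] sub by blast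
      then have "h (?P x) = 0" by (simp add: h_def eigenspace_def)
      then show "x \<bullet> ?P (h One) = 0"
        using selfadjoint_inner[OF h, of "?P x" One] by (simp flip: hyperplane_proj_inner)
    qed
    then show ?thesis by auto
  qed
  then obtain y where y: "G y = ?P (h One)" by blast
  \<comment> \<open>The factor makes \<open>2 * (p i \<bullet> c)\<close> cancel the only term of
    \<open>p i \<bullet> p i\<close> that depends on \<open>i\<close>, namely
    \<open>- 2 / n * (b i \<bullet> h One)\<close>; \<open>R\<close> collects what remains.\<close>
  define c where "c = (- 1 / n) *\<^sub>R T y"
  define R where "R = m + (One \<bullet> h One) / n\<^sup>2 - 2 / n * ((h One \<bullet> One) / n) + c \<bullet> c"
  have R: "(dist (p i) c)\<^sup>2 = R" if i: "i < n" for i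
  proof -
    have Pb: "?P (b i) = b i - (1 / n) *\<^sub>R One"
      using One_inner_b[OF i] One_inner_One by (simp add: hyperplane_proj_def inner_commute[of "b i" One])
    have bb: "b i \<bullet> h (b i) = m"
      using i E_irrefl by (simp add: h_def inner_diff_right inner_b inner_commute[of "b i" "f _"] fb adj_index)
    have "p i \<bullet> p i = ?P (b i) \<bullet> h (?P (b i))"
      by (simp add: p_def T(2) G_def inner_compress)
    also have "\<dots> = m - 2 / n * (b i \<bullet> h One) + (One \<bullet> h One) / n\<^sup>2"
      using selfadjoint_inner[OF h, of One "b i"] bb
      by (simp add: Pb linear_diff[OF lin(1)] linear_scale[OF lin(1)] inner_diff_left inner_diff_right
          inner_commute[of "h One" "b i"] power2_eq_square diff_divide_distrib)
    finally have pp: "p i \<bullet> p i = m - 2 / n * (b i \<bullet> h One) + (One \<bullet> h One) / n\<^sup>2" .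
    have "p i \<bullet> T y = b i \<bullet> ?P (h One)" by (simp add: p_def T(2) y)
    also have "\<dots> = b i \<bullet> h One - (h One \<bullet> One) / n"
      using One_inner_b[OF i] One_inner_One
      by (simp add: hyperplane_proj_def inner_diff_right inner_commute[of "b i" One])
    finally have pT: "p i \<bullet> T y = b i \<bullet> h One - (h One \<bullet> One) / n" .
    have "(dist (p i) c)\<^sup>2 = p i \<bullet> p i - 2 * (p i \<bullet> c) + c \<bullet> c"
      by (simp add: dist_norm power2_norm_eq_inner inner_diff_left inner_diff_right inner_commute)
    also have "p i \<bullet> c = - 1 / n * (p i \<bullet> T y)" by (simp add: c_def)
    finally show ?thesis unfolding pp pT R_def by (simp add: algebra_simps)
  qed
  have "\<forall>i<n. dist (p i) c = sqrt R"
    using R by (auto intro!: real_sqrt_unique[symmetric])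
  \<comment> \<open>Otherwise every point would coincide with the centre.\<close>
  moreover have "0 < sqrt R"
  proof (rule ccontr)
    assume "\<not> 0 < sqrt R"
    then have "R \<le> 0" by simp
    then have "p i = c" if "i < n" for i using R[OF that] by (smt (verit) dist_eq_0_iff zero_less_power2)
    then have "p 0 = p 1" using two_le_n by simp
    then show False using inj two_le_n by (auto dest: inj_onD)
  qed
  ultimately show ?thesis unfolding spherical_rep_def by blast
qed

end

theorem theorem1p1:
  fixes d :: nat and E :: "nat \<Rightarrow> nat \<Rightarrow> bool" and lam :: "real list"
  assumes "d \<ge> 1"
    and "DIM('a::euclidean_space) = d"
    and "simple_graph (d + 2) E"
    and "length lam = d + 2"
    and "sorted_wrt (\<ge>) lam"
    and "char_poly (adj_mat (d + 2) E) = (\<Prod>i<d + 2. [:- (lam ! i), 1:])"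
  shows "spherical_rep TYPE('a) (d + 2) E \<longleftrightarrow>
    (let A = adj_mat (d + 2) E; P = proj_mat (d + 2); M = P * A * P in
       max_eigenvalue M = lam ! 1 \<and>
       eig_mult A (lam ! 1) - (if lam ! 0 = lam ! 1 then 1 else 0) = eig_mult M (lam ! 1))"
proof -
  have "card (Basis :: ('a \<times> real \<times> real) set) = d + 2" using assms(2) by simp
  then obtain b :: "nat \<Rightarrow> 'a \<times> real \<times> real" where "bij_betw b {..<d + 2} Basis"
    using ex_bij_betw_nat_finite[of "Basis :: ('a \<times> real \<times> real) set"] by (auto simp: atLeast0LessThan)
  then interpret graph_operator "d + 2" b E
    using assms(3) by unfold_locales auto
  obtain w where "compression_spectrum f One (max_eigenvalue M) (lam ! 0) (lam ! 1) w"
    using compression_spectrum_adjacency[OF assms(4,5,6)] by blast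
  then interpret compression_spectrum f One "max_eigenvalue M" "lam ! 0" "lam ! 1" w .
  have "spherical_rep TYPE('a) (d + 2) E \<longleftrightarrow>
      0 < max_eigenvalue M \<and> eigenspace g (max_eigenvalue M) \<subseteq> eigenspace f (max_eigenvalue M)"
    using spherical_rep_imp_top_eigenspace_subset top_eigenspace_subset_imp_spherical_rep
      top_compression_max_eigenvalue assms(2) by metis
  then show ?thesis
    using top_eigenspace_subset_iff by (simp only: Let_def eig_mult_A eig_mult_M)
qed

end
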